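(* Let $\alpha,\beta\in(0,1/2]$. Then the double inequality $$\frac{\pi}{4}\left(\sqrt{\beta+(1-\beta){r'}^2}+\sqrt{(1-\beta)+\beta{r'}^2}\right)<\mathcal{E}(r)<\frac{\pi}{4}\left(\sqrt{\alpha+(1-\alpha){r'}^2}+\sqrt{(1-\alpha)+\alpha{r'}^2}\right)$$ holds for all $r\in(0,1)$ if and only if $\beta\leq \frac12-\frac{2\sqrt{2(\pi^2-8)}}{\pi^2}$ and $\alpha\geq \frac12-\frac{\sqrt{2}}{4}$.
   Context: For $r\in(0,1)$, $\mathcal{E}(r)=\int_{0}^{\pi/2}(1-r^2\sin^2\theta)^{1/2}\,d\theta$ is the complete elliptic integral of the second kind, and $r'=\sqrt{1-r^2}$. *)

theory Defs
  imports "HOL-Analysis.Analysis"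
begin

text \<open>The complete elliptic integral of the second kind as a function of the modulus \<open>r\<close>
  (not of the parameter \<open>m = r\<^sup>2\<close>), meant for \<open>0 < r < 1\<close>, where the integrand
  is continuous on \<open>[0, \<pi>/2]\<close>.\<close>

definition ellipticE :: "real \<Rightarrow> real" where
  "ellipticE r = integral {0..pi/2} (\<lambda>\<theta>. sqrt (1 - r\<^sup>2 * (sin \<theta>)\<^sup>2))"

definition compl_modulus :: "real \<Rightarrow> real" where
  "compl_modulus r = sqrt (1 - r\<^sup>2)"

end

theory Submission imports Defs
begin

text \<open>
  Put \<open>m = r\<^sup>2\<close>. Then \<open>2 E(r) / \<pi>\<close> is the mean of \<open>sqrt (1 - m x)\<close> over the arcsine distribution
  (\<open>x = sin\<^sup>2 \<theta>\<close>), while the bounds are \<open>\<pi>/2\<close> times the mean of the same function over the two points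
  \<open>b\<close> and \<open>1 - b\<close>. Expanding in powers of \<open>m\<close> reduces everything to comparing moments, since the
  Taylor coefficients of \<open>sqrt (1 - x)\<close> are negative from the linear term on.
  For \<open>b = 1/2 - sqrt 2 / 4\<close> the points are the Gauss--Chebyshev nodes: the moments agree up to order 3
  and the arcsine moments are larger afterwards. For the critical \<open>\<beta>\<close> the coefficients of the difference
  change sign exactly once, from positive to negative, and the difference vanishes at \<open>m = 1\<close>, so it is
  positive on \<open>(0, 1)\<close>. Necessity comes from the limits \<open>m \<rightarrow> 0\<close> and \<open>m \<rightarrow> 1\<close>.
\<close>

subsection \<open>Moments and Taylor coefficients\<close>

definition sqrt_coeff :: "nat \<Rightarrow> real" where
  "sqrt_coeff k = ((1/2) gchoose k) * (-1) ^ k"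

text \<open>These are the Wallis ratios \<open>binom(2k, k) / 4^k\<close>. The recursive form
  exposes the quotient of consecutive moments, on which the later comparison rests.\<close>

primrec arcsine_moment :: "nat \<Rightarrow> real" where
  "arcsine_moment 0 = 1"
| "arcsine_moment (Suc k) = (2 * real k + 1) / (2 * real k + 2) * arcsine_moment k"

definition two_point_moment :: "real \<Rightarrow> nat \<Rightarrow> real" where
  "two_point_moment b k = (b ^ k + (1 - b) ^ k) / 2"

text \<open>Because \<open>sqrt_coeff k\<close> is negative for k > 0, such a coefficient is
  positive exactly when the two-point moment exceeds the arcsine moment.\<close>

definition gap_coeff :: "real \<Rightarrow> nat \<Rightarrow> real" where
  "gap_coeff b k = sqrt_coeff k * (arcsine_moment k - two_point_moment b k)"

definition arcsine_mean :: "real \<Rightarrow> real" where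
  "arcsine_mean m = 2 / pi * integral {0..pi/2} (\<lambda>\<theta>. sqrt (1 - m * (sin \<theta>)\<^sup>2))"

definition two_point_mean :: "real \<Rightarrow> real \<Rightarrow> real" where
  "two_point_mean b m = (sqrt (1 - (1 - b) * m) + sqrt (1 - b * m)) / 2"

lemma sqrt_coeff_Suc: "sqrt_coeff (Suc k) = sqrt_coeff k * ((real k - 1/2) / (real k + 1))"
proof -
  have "((1/2::real) gchoose Suc k) = ((1/2) gchoose k) * (1/2 - real k) / (real k + 1)"
    using gbinomial_mult_1[of "1/2::real" k] by (simp add: field_simps)
  then show ?thesis
    unfolding sqrt_coeff_def by (simp only:) (simp add: field_simps)
qed

lemma sqrt_coeff_0: "sqrt_coeff 0 = 1"
  by (simp add: sqrt_coeff_def)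

text \<open>The recursion factor (k - 1/2) / (k + 1) is negative only at k = 0, so the sign flips
  once and then stays.\<close>

lemma sqrt_coeff_neg: "sqrt_coeff (Suc k) < 0"
proof (induction k)
  case 0
  show ?case by (simp add: sqrt_coeff_Suc sqrt_coeff_0)
next
  case (Suc k)
  then show ?case
    unfolding sqrt_coeff_Suc[of "Suc k"] by (intro mult_neg_pos) auto
qed

lemma sqrt_coeff_sums:
  assumes "\<bar>x\<bar> < 1"
  shows "(\<lambda>k. sqrt_coeff k * x ^ k) sums sqrt (1 - x)"
  using sqrt_series[of "-x"] assms
  by (simp add: sqrt_coeff_def power_minus[of x] mult.assoc)

text \<open>Wallis reduction: the derivative of sin^(2k+1) cos integrates to zero, since the
  boundary values vanish, and this links consecutive even powers.\<close>

lemma has_integral_sin_even_power: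
  "((\<lambda>\<theta>. (sin \<theta>) ^ (2 * k)) has_integral pi / 2 * arcsine_moment k) {0..pi/2}"
proof (induction k)
  case 0
  show ?case using has_integral_const_real[of "1::real" 0 "pi/2"] by simp
next
  case (Suc k)
  have "((\<lambda>\<theta>. (2 * real k + 1) * sin \<theta> ^ (2 * k) - (2 * real k + 2) * sin \<theta> ^ (2 * Suc k))
      has_integral (sin (pi/2) ^ (2 * k + 1) * cos (pi/2) - sin 0 ^ (2 * k + 1) * cos 0)) {0..pi/2}"
  proof (rule fundamental_theorem_of_calculus)
    fix \<theta> :: real
    have c: "cos \<theta> * cos \<theta> = 1 - sin \<theta> * sin \<theta>"
      using sin_cos_squared_add[of \<theta>] by (simp add: power2_eq_square)
    have "((\<lambda>\<theta>. sin \<theta> ^ (2 * k + 1) * cos \<theta>) has_real_derivative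
        (2 * real k + 1) * sin \<theta> ^ (2 * k) * (cos \<theta> * cos \<theta>) - sin \<theta> ^ (2 * k + 1) * sin \<theta>)
        (at \<theta> within {0..pi/2})"
      by (rule derivative_eq_intros refl)+ (simp add: algebra_simps)
    also have "(2 * real k + 1) * sin \<theta> ^ (2 * k) * (cos \<theta> * cos \<theta>) - sin \<theta> ^ (2 * k + 1) * sin \<theta>
        = (2 * real k + 1) * sin \<theta> ^ (2 * k) - (2 * real k + 2) * sin \<theta> ^ (2 * Suc k)"
      unfolding c by (simp add: algebra_simps)
    finally show "((\<lambda>\<theta>. sin \<theta> ^ (2 * k + 1) * cos \<theta>) has_vector_derivative
        (2 * real k + 1) * sin \<theta> ^ (2 * k) - (2 * real k + 2) * sin \<theta> ^ (2 * Suc k))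
        (at \<theta> within {0..pi/2})"
      by (simp only: has_real_derivative_iff_has_vector_derivative)
  qed simp
  from has_integral_diff[OF has_integral_mult_right[OF Suc, of "2 * real k + 1"] this]
  have "((\<lambda>\<theta>. (2 * real k + 2) * sin \<theta> ^ (2 * Suc k)) has_integral
      (2 * real k + 1) * (pi / 2 * arcsine_moment k)) {0..pi/2}"
    by simp
  from has_integral_divide[OF this, of "2 * real k + 2"]
  show ?case
    by (simp add: mult_ac del: power_Suc mult_Suc_right)
qed

text \<open>The Taylor series is integrated term by term; the M-test applies with majorant
  |\<open>sqrt_coeff k\<close>| |m|^k.\<close>

lemma arcsine_mean_sums:
  assumes "\<bar>m\<bar> < 1"
  shows "(\<lambda>k. sqrt_coeff k * arcsine_moment k * m ^ k) sums arcsine_mean m"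
proof -
  define f where "f = (\<lambda>k \<theta>. sqrt_coeff k * (m * (sin \<theta>)\<^sup>2) ^ k)"
  have sin1: "(sin \<theta>)\<^sup>2 \<le> 1" for \<theta> :: real
    by (simp add: abs_square_le_1)
  have small: "\<bar>m * (sin \<theta>)\<^sup>2\<bar> \<le> \<bar>m\<bar>" for \<theta>
    using mult_left_le[OF sin1, of "\<bar>m\<bar>"] by (simp add: abs_mult)
  have f_sum: "(\<Sum>k. f k \<theta>) = sqrt (1 - m * (sin \<theta>)\<^sup>2)" for \<theta>
    unfolding f_def using small[of \<theta>] assms by (intro sums_unique[symmetric] sqrt_coeff_sums) linarith
  \<comment> \<open>Convergence at the midpoint of |m| and 1 gives absolute convergence at
    |m|.\<close>
  have "summable (\<lambda>k. norm (sqrt_coeff k * \<bar>m\<bar> ^ k))"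
    using sums_summable[OF sqrt_coeff_sums[of "(\<bar>m\<bar> + 1) / 2"]] assms
    by (intro powser_insidea[where x = "(\<bar>m\<bar> + 1) / 2"]) auto
  moreover have "norm (f k \<theta>) \<le> norm (sqrt_coeff k * \<bar>m\<bar> ^ k)" for k \<theta>
    unfolding f_def norm_mult norm_power
    using small[of \<theta>] by (intro mult_left_mono power_mono) auto
  ultimately have "uniform_limit {0..pi/2} (\<lambda>n \<theta>. \<Sum>k<n. f k \<theta>) (\<lambda>\<theta>. sqrt (1 - m * (sin \<theta>)\<^sup>2))
      sequentially"
    using Weierstrass_m_test[of "{0..pi/2}" f "\<lambda>k. norm (sqrt_coeff k * \<bar>m\<bar> ^ k)"]
    by (simp add: f_sum)
  moreover have "continuous_on {0..pi/2} (\<lambda>\<theta>. \<Sum>k<n. f k \<theta>)" for n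
    unfolding f_def by (intro continuous_intros)
  ultimately obtain I J where
    I: "\<And>n. ((\<lambda>\<theta>. \<Sum>k<n. f k \<theta>) has_integral I n) {0..pi/2}"
    and J: "((\<lambda>\<theta>. sqrt (1 - m * (sin \<theta>)\<^sup>2)) has_integral J) {0..pi/2}"
    and lim: "I \<longlonglongrightarrow> J"
    by (rule uniform_limit_integral) auto
  have "f k = (\<lambda>\<theta>. sqrt_coeff k * m ^ k * sin \<theta> ^ (2 * k))" for k
    by (simp add: f_def power_mult_distrib power_mult mult.assoc)
  then have "(f k has_integral pi / 2 * (sqrt_coeff k * arcsine_moment k * m ^ k)) {0..pi/2}" for k
    using has_integral_mult_right[OF has_integral_sin_even_power[of k], of "sqrt_coeff k * m ^ k"]
    by (simp add: mult_ac)
  then have "((\<lambda>\<theta>. \<Sum>k<n. f k \<theta>) has_integral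
      (\<Sum>k<n. pi / 2 * (sqrt_coeff k * arcsine_moment k * m ^ k))) {0..pi/2}" for n
    by (intro has_integral_sum) auto
  then have "I = (\<lambda>n. \<Sum>k<n. pi / 2 * (sqrt_coeff k * arcsine_moment k * m ^ k))"
    using I has_integral_unique by blast
  with lim have "(\<lambda>k. pi / 2 * (sqrt_coeff k * arcsine_moment k * m ^ k)) sums J"
    by (simp add: sums_def)
  from sums_mult[OF this, of "2 / pi"] show ?thesis
    using integral_unique[OF J] by (simp add: arcsine_mean_def mult.assoc)
qed

lemma two_point_mean_sums:
  assumes "\<bar>m\<bar> < 1" "0 \<le> b" "b \<le> 1"
  shows "(\<lambda>k. sqrt_coeff k * two_point_moment b k * m ^ k) sums two_point_mean b m"
proof -
  have "\<bar>c * m\<bar> < 1" if "0 \<le> c" "c \<le> 1" for c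
    using mult_left_le_one_le[of "\<bar>m\<bar>" c] assms that by (simp add: abs_mult)
  then have "(\<lambda>k. (sqrt_coeff k * ((1 - b) * m) ^ k + sqrt_coeff k * (b * m) ^ k) / 2) sums
      two_point_mean b m"
    unfolding two_point_mean_def using assms
    by (intro sums_divide sums_add sqrt_coeff_sums) auto
  then show ?thesis
    by (simp add: two_point_moment_def power_mult_distrib distrib_left distrib_right
        add_divide_distrib mult_ac add_ac)
qed

lemma gap_sums:
  assumes "\<bar>m\<bar> < 1" "0 \<le> b" "b \<le> 1"
  shows "(\<lambda>k. gap_coeff b k * m ^ k) sums (arcsine_mean m - two_point_mean b m)"
  using sums_diff[OF arcsine_mean_sums two_point_mean_sums] assms
  by (simp add: gap_coeff_def algebra_simps)

section \<open>The elliptic integral and the endpoint m = 1\<close>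

lemma ellipticE_eq_arcsine_mean: "ellipticE r = pi / 2 * arcsine_mean (r\<^sup>2)"
  by (simp add: ellipticE_def arcsine_mean_def)

lemma arcsine_mean_1: "arcsine_mean 1 = 2 / pi"
proof -
  have "((\<lambda>\<theta>. cos \<theta>) has_integral sin (pi/2) - sin 0) {0..pi/2}"
    by (rule fundamental_theorem_of_calculus)
      (auto intro!: derivative_eq_intros simp flip: has_real_derivative_iff_has_vector_derivative)
  moreover have "sqrt (1 - 1 * (sin \<theta>)\<^sup>2) = cos \<theta>" if "\<theta> \<in> {0..pi/2}" for \<theta>
    using that cos_ge_zero[of \<theta>] by (simp flip: cos_squared_eq)
  ultimately have "((\<lambda>\<theta>. sqrt (1 - 1 * (sin \<theta>)\<^sup>2)) has_integral 1) {0..pi/2}"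
    by (subst has_integral_cong[where g = cos]) auto
  then show ?thesis
    by (simp add: arcsine_mean_def integral_unique)
qed

lemma tendsto_gap_1:
  "((\<lambda>m. arcsine_mean m - two_point_mean b m) \<longlongrightarrow> 2 / pi - (sqrt b + sqrt (1 - b)) / 2) (at_left 1)"
proof -
  \<comment> \<open>The expansions cover only |m| < 1, so the endpoint is reached by continuity of
    the integral in m. As \<open>sqrt\<close> is continuous on the whole real line, m may range over
    \<open>UNIV\<close>.\<close>
  have "continuous_on UNIV (\<lambda>m. integral (cbox 0 (pi/2)) (\<lambda>\<theta>. sqrt (1 - m * (sin \<theta>)\<^sup>2)))"
    by (rule integral_continuous_on_param) (auto simp: split_beta intro!: continuous_intros)
  then have "continuous_on UNIV (\<lambda>m. arcsine_mean m - two_point_mean b m)"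
    unfolding arcsine_mean_def two_point_mean_def by (auto intro!: continuous_intros)
  then have "((\<lambda>m. arcsine_mean m - two_point_mean b m) \<longlongrightarrow> arcsine_mean 1 - two_point_mean b 1) (at 1)"
    by (simp add: continuous_on_def)
  then show ?thesis
    using tendsto_within_subset[of _ _ _ UNIV] by (fastforce simp: arcsine_mean_1 two_point_mean_def)
qed

subsection \<open>Power series whose coefficients change sign once\<close>

text \<open>If N is the first index with a negative coefficient, f(x) / x^N is strictly decreasing.
  A value f(x) \<le> 0 would therefore keep f below a negative constant near 1, against L \<ge>
  0.\<close>

lemma power_series_pos:
  fixes d :: "nat \<Rightarrow> real"
  assumes sums: "\<And>x. x \<in> {0<..<1} \<Longrightarrow> (\<lambda>k. d k * x ^ k) sums f x"
    and sign: "\<And>k l. d k < 0 \<Longrightarrow> k \<le> l \<Longrightarrow> d l \<le> 0"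
    and pos: "0 < d j"
    and lim: "(f \<longlongrightarrow> L) (at_left 1)" and L: "0 \<le> L"
    and x: "x \<in> {0<..<1}"
  shows "0 < f x"
proof (cases "\<exists>k. d k < 0")
  case False
  then have "0 < (\<Sum>k. d k * x ^ k)"
    using pos x by (intro suminf_pos2[where i = j] sums_summable[OF sums]) (auto simp: not_less)
  then show ?thesis
    using sums_unique[OF sums[OF x]] by simp
next
  case True
  define N where "N = (LEAST k. d k < 0)"
  have N: "d N < 0"
    unfolding N_def using True by (rule LeastI_ex)
  have below: "0 \<le> d k" if "k < N" for k
    using not_less_Least[of k "\<lambda>k. d k < 0"] that by (simp add: N_def not_less)
  have above: "d k \<le> 0" if "N \<le> k" for k
    using sign[OF N that] .
  have jN: "j < N"
    using above[of j] pos by force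
  \<comment> \<open>\<open>f y / y ^ N\<close> is decreasing, stated without negative exponents.\<close>
  have decr: "f (t * y) < t ^ N * f y" if y: "0 < y" "1 < t" "t * y < 1" for t y
  proof -
    have "y < t * y" using y by simp
    then have "y < 1" using y(3) by (rule less_trans)
    then have y1: "y \<in> {0<..<1}" "t * y \<in> {0<..<1}" using y by auto
    let ?g = "\<lambda>k. t ^ N * (d k * y ^ k) - d k * (t * y) ^ k"
    \<comment> \<open>Both \<open>d k\<close> and t^N - t^k change sign at k = N, so every term is
      nonnegative; the one at j < N is positive.\<close>
    have g: "?g k = d k * y ^ k * (t ^ N - t ^ k)" for k
      by (simp add: algebra_simps power_mult_distrib)
    have "?g sums (t ^ N * f y - f (t * y))"
      using y1 by (intro sums_diff sums_mult sums)
    moreover have "0 < suminf ?g"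
    proof (rule suminf_pos2[where i = j])
      show "summable ?g" using calculation by (rule sums_summable)
      show "0 \<le> ?g k" for k
      proof (cases "k < N")
        case True
        then have "t ^ k \<le> t ^ N" using y by (intro power_increasing) auto
        then show ?thesis unfolding g using below[OF True] y by simp
      next
        case False
        then have "t ^ N \<le> t ^ k" using y by (intro power_increasing) auto
        then show ?thesis unfolding g using above[of k] False y
          by (intro mult_nonpos_nonpos mult_nonpos_nonneg) auto
      qed
      have "t ^ j < t ^ N" using jN y by (intro power_strict_increasing) auto
      then show "0 < ?g j" unfolding g using pos y by simp
    qed
    ultimately show ?thesis
      by (simp add: sums_unique[symmetric])
  qed
  show ?thesis
  proof (rule ccontr)
    assume "\<not> 0 < f x"
    then have fx: "f x \<le> 0" by simp
    \<comment> \<open>The intermediate point turns f(x) \<le> 0 into the strict f(y) < 0, which then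
      bounds f from above on all of (y, 1).\<close>
    define y where "y = (x + 1) / 2"
    have y: "x < y" "0 < y" "y < 1" using x by (auto simp: y_def)
    have "f y < (y / x) ^ N * f x"
      using decr[of x "y / x"] x y by simp
    also have "\<dots> \<le> 0"
      using fx x y by (intro mult_nonneg_nonpos) auto
    finally have fy: "f y < 0" .
    have "f z \<le> f y" if z: "y < z" "z < 1" for z
    proof -
      have "f z < (z / y) ^ N * f y"
        using decr[of y "z / y"] y z by simp
      also have "\<dots> \<le> 1 * f y"
        using fy y z by (intro mult_right_mono_neg one_le_power) auto
      finally show ?thesis by simp
    qed
    then have "eventually (\<lambda>z. f z \<le> f y) (at_left 1)"
      using y by (auto simp: eventually_at_left)
    with lim have "L \<le> f y"
      by (intro tendsto_upperbound) auto
    then show False using fy L by simp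
  qed
qed

subsection \<open>Comparing the moments\<close>

lemma two_point_moment_Suc_le:
  assumes "0 \<le> b" "b \<le> 1/2"
  shows "two_point_moment b (Suc k) \<le> (1 - b) * two_point_moment b k"
proof -
  have "b * b ^ k \<le> (1 - b) * b ^ k"
    using assms by (intro mult_right_mono) auto
  then show ?thesis
    by (simp add: two_point_moment_def distrib_left)
qed

lemma arcsine_moment_pos: "0 < arcsine_moment k"
  by (induction k) auto

text \<open>The arcsine ratio (2k+1) / (2k+2) increases with k, whereas the two-point moments grow
  by a factor of at most the larger node 1 - b. Once the former ratio has reached 1 - b, the
  inequality propagates upwards.\<close>

lemma moments_le_from:
  assumes b: "0 \<le> b" "b \<le> 1/2" and k: "1 - b \<le> (2 * real k + 1) / (2 * real k + 2)"
    and le: "two_point_moment b k \<le> arcsine_moment k" and "k \<le> l"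
  shows "two_point_moment b l \<le> arcsine_moment l"
  using \<open>k \<le> l\<close>
proof (induction l rule: dec_induct)
  case base
  show ?case by (rule le)
next
  case (step l)
  have "(2 * real k + 1) / (2 * real k + 2) \<le> (2 * real l + 1) / (2 * real l + 2)"
    using step.hyps by (simp add: field_simps)
  then have l: "1 - b \<le> (2 * real l + 1) / (2 * real l + 2)"
    using k by linarith
  have "two_point_moment b (Suc l) \<le> (1 - b) * two_point_moment b l"
    using b by (rule two_point_moment_Suc_le)
  also have "\<dots> \<le> (2 * real l + 1) / (2 * real l + 2) * arcsine_moment l"
    using b l step.IH arcsine_moment_pos[of l] by (intro mult_mono) (auto simp: two_point_moment_def)
  finally show ?case by simp
qed

lemma arcsine_moment_values:
  "arcsine_moment 1 = 1/2" "arcsine_moment 2 = 3/8" "arcsine_moment 3 = 5/16"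
  "arcsine_moment 4 = 35/128"
  by (simp_all add: eval_nat_numeral)

text \<open>With nodes 1/2 - s and 1/2 + s, odd powers of s cancel and only the square of s
  remains.\<close>

lemma two_point_moment_values:
  fixes s :: real
  shows "two_point_moment (1/2 - s) 0 = 1" "two_point_moment (1/2 - s) 1 = 1/2"
  "two_point_moment (1/2 - s) 2 = 1/4 + s\<^sup>2"
  "two_point_moment (1/2 - s) 3 = 1/8 + 3/2 * s\<^sup>2"
  "two_point_moment (1/2 - s) 4 = 1/16 + 3/2 * s\<^sup>2 + (s\<^sup>2)\<^sup>2"
  by (simp_all add: two_point_moment_def eval_nat_numeral field_simps)

lemma nat_less_5_cases: "k < 5 \<Longrightarrow> k = 0 \<or> k = 1 \<or> k = 2 \<or> k = 3 \<or> k = (4::nat)"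
  by auto

lemma gauss_chebyshev_upper:
  assumes m: "0 < m" "m < 1"
  shows "arcsine_mean m < two_point_mean (1/2 - sqrt 2 / 4) m"
proof -
  define s :: real where "s = sqrt 2 / 4"
  \<comment> \<open>The bound 3/8 keeps the larger node 1/2 + s below 7/8, the arcsine ratio at k =
    3, so propagation can start there.\<close>
  have s: "s\<^sup>2 = 1/8" "0 \<le> s" "s \<le> 3/8"
  proof -
    show "s\<^sup>2 = 1/8" "0 \<le> s" by (auto simp: s_def power_divide)
    show "s \<le> 3/8" by (rule power2_le_imp_le) (auto simp: s_def power_divide)
  qed
  have le: "two_point_moment (1/2 - s) k \<le> arcsine_moment k" for k
  proof (cases "k < 3")
    case True
    then have "k = 0 \<or> k = 1 \<or> k = 2" by auto
    then show ?thesis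
      using s by (auto simp: two_point_moment_values arcsine_moment_values simp del: One_nat_def)
  next
    case False
    show ?thesis
      by (rule moments_le_from[where k = 3])
        (use s False in \<open>auto simp: two_point_moment_values arcsine_moment_values\<close>)
  qed
  have nonneg: "0 \<le> - gap_coeff (1/2 - s) k" for k
  proof (cases k)
    case 0
    then show ?thesis by (simp add: gap_coeff_def two_point_moment_def)
  next
    case (Suc n)
    then show ?thesis
      using le[of k] sqrt_coeff_neg[of n] by (simp add: gap_coeff_def mult_nonpos_nonneg)
  qed
  \<comment> \<open>Order 4 supplies strictness: the moments are 34/128 and 35/128.\<close>
  have "sqrt_coeff 4 < 0"
    using sqrt_coeff_neg[of 3] by simp
  moreover have "two_point_moment (1/2 - s) 4 = 17/64"
    unfolding two_point_moment_values s by (simp add: power_divide)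
  ultimately have pos: "0 < - gap_coeff (1/2 - s) 4"
    unfolding gap_coeff_def arcsine_moment_values by (simp add: mult_less_0_iff)
  have sums: "(\<lambda>k. - gap_coeff (1/2 - s) k * m ^ k) sums - (arcsine_mean m - two_point_mean (1/2 - s) m)"
    using sums_minus[OF gap_sums[of m "1/2 - s"]] m s by simp
  have "0 < (\<Sum>k. - gap_coeff (1/2 - s) k * m ^ k)"
    using m nonneg pos by (intro suminf_pos2[where i = 4] sums_summable[OF sums] mult_nonneg_nonneg mult_pos_pos) auto
  then show ?thesis
    using sums_unique[OF sums] by (simp add: s_def)
qed

text \<open>The numerical bounds on s locate the sign change: the lower one makes the two-point
  moments dominate up to order 4, the upper one starts propagation in the other direction from order
  5. Hypothesis \<open>L\<close> says that the limit of the gap at m = 1 is nonnegative.\<close>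

lemma two_point_lower:
  fixes s :: real
  assumes s: "0 \<le> s" "s \<le> 2/5" "13/100 \<le> s\<^sup>2"
    and L: "sqrt (1/2 - s) + sqrt (1/2 + s) \<le> 4 / pi"
    and m: "0 < m" "m < 1"
  shows "two_point_mean (1/2 - s) m < arcsine_mean m"
proof -
  have sq: "(13/100)\<^sup>2 \<le> (s\<^sup>2)\<^sup>2"
    using s by (intro power_mono) auto
  \<comment> \<open>Order 4 is the demanding case; for orders 2 and 3 a squared shift of 1/8 would
    suffice.\<close>
  have low: "arcsine_moment k \<le> two_point_moment (1/2 - s) k" if "k < 5" for k
    using nat_less_5_cases[OF that] s sq
    by (auto simp: two_point_moment_values arcsine_moment_values power_divide simp del: One_nat_def)
  have c2: "sqrt_coeff 2 < 0"
    using sqrt_coeff_neg[of 1] by (simp add: eval_nat_numeral)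
  have "0 < arcsine_mean m - two_point_mean (1/2 - s) m"
  proof (rule power_series_pos[where d = "gap_coeff (1/2 - s)" and j = 2 and x = m
        and f = "\<lambda>m. arcsine_mean m - two_point_mean (1/2 - s) m"])
    show "(\<lambda>k. gap_coeff (1/2 - s) k * x ^ k) sums (arcsine_mean x - two_point_mean (1/2 - s) x)"
      if "x \<in> {0<..<1}" for x
      using that s by (intro gap_sums) auto
    show "gap_coeff (1/2 - s) l \<le> 0" if neg: "gap_coeff (1/2 - s) k < 0" and "k \<le> l" for k l
    proof -
      have "0 < k"
        using neg by (cases k) (auto simp: gap_coeff_def two_point_moment_def)
      then have ck: "sqrt_coeff k < 0" and cl: "sqrt_coeff l < 0"
        using sqrt_coeff_neg[of "k - 1"] sqrt_coeff_neg[of "l - 1"] \<open>k \<le> l\<close> by auto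
      from neg ck have less: "two_point_moment (1/2 - s) k < arcsine_moment k"
        by (simp add: gap_coeff_def mult_less_0_iff)
      with low[of k] have "5 \<le> k" by force
      then have "9/10 \<le> (2 * real k + 1) / (2 * real k + 2)"
        by (simp add: field_simps)
      then have "1 - (1/2 - s) \<le> (2 * real k + 1) / (2 * real k + 2)"
        using s(2) by linarith
      moreover have "0 \<le> 1/2 - s" "1/2 - s \<le> 1/2"
        using s(1,2) by auto
      ultimately have "two_point_moment (1/2 - s) l \<le> arcsine_moment l"
        using less \<open>k \<le> l\<close> by (intro moments_le_from[OF _ _ _ less_imp_le[OF less]])
      then show ?thesis
        using cl by (simp add: gap_coeff_def mult_nonpos_nonneg)
    qed
    show "0 < gap_coeff (1/2 - s) 2"
      unfolding gap_coeff_def two_point_moment_values arcsine_moment_values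
      using c2 s by (intro mult_neg_neg) auto
    show "((\<lambda>m. arcsine_mean m - two_point_mean (1/2 - s) m) \<longlongrightarrow>
        2 / pi - (sqrt (1/2 - s) + sqrt (1 - (1/2 - s))) / 2) (at_left 1)"
      by (rule tendsto_gap_1)
    show "0 \<le> 2 / pi - (sqrt (1/2 - s) + sqrt (1 - (1/2 - s))) / 2"
      using L by (simp add: algebra_simps)
  qed (use m in auto)
  then show ?thesis by simp
qed

subsection \<open>The two-point mean as a function of the nodes\<close>

lemma sqrt_add_sqrt_squared:
  fixes u v :: real
  assumes "0 \<le> u" "0 \<le> v"
  shows "(sqrt u + sqrt v)\<^sup>2 = u + v + 2 * sqrt (u * v)"
  using assms by (simp add: power2_sum real_sqrt_mult)

text \<open>The radicands add up to 2 - m whatever the node, so the squared sum depends on b only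
  through their product, which grows with b on [0, 1/2]. This reduces sufficiency to the critical
  parameters.\<close>

lemma two_point_mean_mono:
  assumes "0 \<le> b" "b \<le> c" "c \<le> 1/2" "0 \<le> m" "m \<le> 1"
  shows "two_point_mean b m \<le> two_point_mean c m"
proof -
  have le1: "0 \<le> 1 - x * m" if "0 \<le> x" "x \<le> 1" for x
    using that assms by (simp add: mult_le_one)
  have nonneg: "0 \<le> 1 - (1 - b) * m" "0 \<le> 1 - b * m" "0 \<le> 1 - (1 - c) * m" "0 \<le> 1 - c * m"
    using assms by (intro le1; simp)+
  have "0 \<le> (c - b) * (1 - b - c) * m\<^sup>2"
    using assms by (intro mult_nonneg_nonneg) auto
  then have "(1 - (1 - b) * m) * (1 - b * m) \<le> (1 - (1 - c) * m) * (1 - c * m)"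
    by (simp add: algebra_simps power2_eq_square)
  then have "sqrt ((1 - (1 - b) * m) * (1 - b * m)) \<le> sqrt ((1 - (1 - c) * m) * (1 - c * m))"
    by (rule real_sqrt_le_mono)
  moreover have "1 - (1 - x) * m + (1 - x * m) = 2 - m" for x
    by (simp add: algebra_simps)
  ultimately have "(sqrt (1 - (1 - b) * m) + sqrt (1 - b * m))\<^sup>2 \<le> (sqrt (1 - (1 - c) * m) + sqrt (1 - c * m))\<^sup>2"
    unfolding sqrt_add_sqrt_squared[OF nonneg(1,2)] sqrt_add_sqrt_squared[OF nonneg(3,4)] by simp
  then have "sqrt (1 - (1 - b) * m) + sqrt (1 - b * m) \<le> sqrt (1 - (1 - c) * m) + sqrt (1 - c * m)"
    by (rule power2_le_imp_le) (use nonneg in auto)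
  then show ?thesis by (simp add: two_point_mean_def)
qed

text \<open>This is the comparison at m = 1 solved for s by squaring twice. The second squaring is
  reversible because pi < 4 makes 8 / pi^2 - 1/2 nonnegative.\<close>

lemma sqrt_add_sqrt_le_iff:
  fixes s :: real
  assumes "0 \<le> s" "s \<le> 1/2"
  shows "sqrt (1/2 - s) + sqrt (1/2 + s) \<le> 4 / pi \<longleftrightarrow> 2 * sqrt (2 * (pi\<^sup>2 - 8)) / pi\<^sup>2 \<le> s"
proof -
  have "pi\<^sup>2 < 4\<^sup>2"
    using pi_less_4 by (intro power_strict_mono) auto
  then have pos: "0 \<le> 8 / pi\<^sup>2 - 1/2" by (simp add: field_simps)
  have "3\<^sup>2 \<le> pi\<^sup>2"
    using pi_approx by (intro power_mono) auto
  then have pi8: "8 \<le> pi\<^sup>2" by simp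
  have "sqrt (1/2 - s) + sqrt (1/2 + s) \<le> 4 / pi \<longleftrightarrow> (sqrt (1/2 - s) + sqrt (1/2 + s))\<^sup>2 \<le> (4 / pi)\<^sup>2"
    using assms by (intro power_mono_iff[symmetric]) auto
  also have "\<dots> \<longleftrightarrow> sqrt (1/4 - s\<^sup>2) \<le> 8 / pi\<^sup>2 - 1/2"
    using assms by (subst sqrt_add_sqrt_squared) (auto simp: power_divide field_simps power2_eq_square)
  also have "\<dots> \<longleftrightarrow> 1/4 - s\<^sup>2 \<le> (8 / pi\<^sup>2 - 1/2)\<^sup>2"
    using pos real_le_rsqrt real_sqrt_le_iff real_sqrt_abs abs_of_nonneg by metis
  also have "\<dots> \<longleftrightarrow> (2 * sqrt (2 * (pi\<^sup>2 - 8)) / pi\<^sup>2)\<^sup>2 \<le> s\<^sup>2"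
  proof -
    \<comment> \<open>With y = pi^2 this identity produces the closed form of the critical
      shift.\<close>
    have "1/4 - (8 / y - 1/2)\<^sup>2 = 8 * (y - 8) / y\<^sup>2" if "0 < y" for y :: real
      using that by (simp add: field_simps power2_eq_square)
    from this[of "pi\<^sup>2"] have "1/4 - (8 / pi\<^sup>2 - 1/2)\<^sup>2 = (2 * sqrt (2 * (pi\<^sup>2 - 8)) / pi\<^sup>2)\<^sup>2"
      using pi8 by (simp add: power_mult_distrib power_divide)
    then show ?thesis by linarith
  qed
  also have "\<dots> \<longleftrightarrow> 2 * sqrt (2 * (pi\<^sup>2 - 8)) / pi\<^sup>2 \<le> s"
    using assms pi8 by (intro power_mono_iff) auto
  finally show ?thesis .
qed

lemma critical_shift_bounds:
  defines "s \<equiv> 2 * sqrt (2 * (pi\<^sup>2 - 8)) / pi\<^sup>2"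
  shows "0 \<le> s" "s \<le> 2/5" "13/100 \<le> s\<^sup>2"
proof -
  have "(31/10)\<^sup>2 \<le> pi\<^sup>2" "pi\<^sup>2 \<le> (315/100)\<^sup>2"
    using pi_approx by (intro power_mono; simp)+
  then have y: "961/100 \<le> pi\<^sup>2" "pi\<^sup>2 \<le> 10"
    by (auto simp: power_divide)
  then show nonneg: "0 \<le> s" by (simp add: s_def)
  have s2: "s\<^sup>2 = 8 * (pi\<^sup>2 - 8) / (pi\<^sup>2)\<^sup>2"
    using y by (simp add: s_def power_mult_distrib power_divide)
  have "8 * (y - 8) \<le> 4/25 * y\<^sup>2 \<and> 13/100 * y\<^sup>2 \<le> 8 * (y - 8)" if "961/100 \<le> y" "y \<le> 10" for y :: real
  proof -
    \<comment> \<open>The first product is a multiple of the first claim's difference. The second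
      bounds y^2 by its chord over [9.61, 10], leaving a linear inequality.\<close>
    have "0 \<le> (10 - y) * (40 - y)" "0 \<le> (100 * y - 961) * (10 - y)"
      using that by (intro mult_nonneg_nonneg; simp)+
    then have "50 * y - 400 \<le> y\<^sup>2" "y\<^sup>2 \<le> 1961/100 * y - 961/10"
      by (simp_all add: power2_eq_square algebra_simps)
    then show ?thesis using that by (simp add: algebra_simps)
  qed
  from this[OF y] have "s\<^sup>2 \<le> (2/5)\<^sup>2" "13/100 \<le> s\<^sup>2"
    by (simp_all add: s2 divide_le_eq le_divide_eq power_divide)
  then show "s \<le> 2/5" "13/100 \<le> s\<^sup>2"
    using power2_le_imp_le[of s "2/5"] by simp_all
qed

subsection \<open>Necessity\<close>

text \<open>Strict inequalities become weak as m tends to 1, so the critical value itself is not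
  excluded.\<close>

lemma lower_bound_necessary:
  assumes b: "0 < b" "b \<le> 1/2"
    and lower: "\<And>m. 0 < m \<Longrightarrow> m < 1 \<Longrightarrow> two_point_mean b m < arcsine_mean m"
  shows "b \<le> 1/2 - 2 * sqrt (2 * (pi\<^sup>2 - 8)) / pi\<^sup>2"
proof -
  have "eventually (\<lambda>m. 0 \<le> arcsine_mean m - two_point_mean b m) (at_left 1)"
    unfolding eventually_at_left[OF zero_less_one] using lower by (intro exI[of _ 0]) (auto intro: less_imp_le)
  from tendsto_lowerbound[OF tendsto_gap_1 this]
  have "sqrt b + sqrt (1 - b) \<le> 4 / pi" by simp
  then show ?thesis
    using sqrt_add_sqrt_le_iff[of "1/2 - b"] b by simp
qed

lemma upper_bound_necessary:
  assumes b: "0 < b" "b \<le> 1/2"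
    and upper: "\<And>m. 0 < m \<Longrightarrow> m < 1 \<Longrightarrow> arcsine_mean m < two_point_mean b m"
  shows "1/2 - sqrt 2 / 4 \<le> b"
proof -
  define s where "s = 1/2 - b"
  have b_eq: "b = 1/2 - s" by (simp add: s_def)
  have d01: "gap_coeff b 0 = 0" "gap_coeff b 1 = 0"
    unfolding b_eq gap_coeff_def two_point_moment_values arcsine_moment_values by simp_all
  \<comment> \<open>The gap coefficients of orders 0 and 1 vanish, so dividing by m^2 isolates the
    one of order 2 as m tends to 0; its sign bounds s.\<close>
  let ?q = "\<lambda>m. (arcsine_mean m - two_point_mean b m) / m\<^sup>2"
  have "(?q \<longlongrightarrow> gap_coeff b (0 + 2)) (at 0)"
  proof (rule powser_limit_0_strong[of 1])
    fix x :: real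
    assume x: "x \<noteq> 0" "norm x < 1"
    have "(\<lambda>k. gap_coeff b (k + 2) * x ^ (k + 2)) sums (arcsine_mean x - two_point_mean b x)"
      using sums_split_initial_segment[OF gap_sums[of x b], of 2] x b d01
      by (simp add: eval_nat_numeral)
    from sums_divide[OF this, of "x\<^sup>2"]
    show "(\<lambda>k. gap_coeff b (k + 2) * x ^ k) sums ?q x"
      using x by (simp add: power_add del: add_2_eq_Suc')
  qed simp
  then have "(?q \<longlongrightarrow> gap_coeff b 2) (at_right 0)"
    by (simp add: filterlim_at_split numeral_2_eq_2)
  moreover have "eventually (\<lambda>m. ?q m \<le> 0) (at_right 0)"
    unfolding eventually_at_right[OF zero_less_one]
    using upper by (intro exI[of _ 1]) (auto intro!: divide_nonpos_pos simp: less_imp_le)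
  ultimately have "gap_coeff b 2 \<le> 0"
    by (intro tendsto_upperbound) auto
  moreover have "sqrt_coeff 2 < 0"
    using sqrt_coeff_neg[of 1] by (simp add: eval_nat_numeral)
  ultimately have "s\<^sup>2 \<le> 1/8"
    by (simp add: b_eq gap_coeff_def two_point_moment_values arcsine_moment_values mult_le_0_iff)
  then have "s \<le> sqrt 2 / 4"
    using power2_le_imp_le[of s "sqrt 2 / 4"] by (simp add: power_divide)
  then show ?thesis by (simp add: b_eq)
qed

section \<open>The equivalence in the original parametrisation\<close>

theorem theorem1p1:
  fixes \<alpha> \<beta> :: real
  assumes "\<alpha> \<in> {0<..1/2}" and "\<beta> \<in> {0<..1/2}"
  shows "(\<forall>r\<in>{0<..<1}.
            pi / 4 * (sqrt (\<beta> + (1 - \<beta>) * (compl_modulus r)\<^sup>2)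
                      + sqrt ((1 - \<beta>) + \<beta> * (compl_modulus r)\<^sup>2)) < ellipticE r
          \<and> ellipticE r < pi / 4 * (sqrt (\<alpha> + (1 - \<alpha>) * (compl_modulus r)\<^sup>2)
                      + sqrt ((1 - \<alpha>) + \<alpha> * (compl_modulus r)\<^sup>2)))
         \<longleftrightarrow> \<beta> \<le> 1/2 - 2 * sqrt (2 * (pi\<^sup>2 - 8)) / pi\<^sup>2 \<and> \<alpha> \<ge> 1/2 - sqrt 2 / 4"
    (is "(\<forall>r\<in>_. ?low r < _ \<and> _ < ?up r) \<longleftrightarrow> _")
proof -
  have mean: "pi / 4 * (sqrt (b + (1 - b) * (compl_modulus r)\<^sup>2) + sqrt ((1 - b) + b * (compl_modulus r)\<^sup>2))
      = pi / 2 * two_point_mean b (r\<^sup>2)" if "r \<in> {0<..<1}" for b r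
  proof -
    have "r\<^sup>2 \<le> 1" using that by (simp add: power_le_one)
    then have c: "(compl_modulus r)\<^sup>2 = 1 - r\<^sup>2" by (simp add: compl_modulus_def)
    have "b + (1 - b) * (1 - r\<^sup>2) = 1 - (1 - b) * r\<^sup>2" "(1 - b) + b * (1 - r\<^sup>2) = 1 - b * r\<^sup>2"
      by (simp_all add: algebra_simps)
    then show ?thesis unfolding c two_point_mean_def by simp
  qed
  have "(\<forall>r\<in>{0<..<1}. ?low r < ellipticE r \<and> ellipticE r < ?up r) \<longleftrightarrow>
      (\<forall>r\<in>{0<..<1}. two_point_mean \<beta> (r\<^sup>2) < arcsine_mean (r\<^sup>2) \<and> arcsine_mean (r\<^sup>2) < two_point_mean \<alpha> (r\<^sup>2))"
    by (intro ball_cong refl) (simp only: mean ellipticE_eq_arcsine_mean, simp)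
  also have "\<dots> \<longleftrightarrow> (\<forall>m\<in>{0<..<1}. two_point_mean \<beta> m < arcsine_mean m \<and> arcsine_mean m < two_point_mean \<alpha> m)"
  proof -
    \<comment> \<open>Squaring maps (0, 1) onto itself, so quantifying over r amounts to quantifying
      over m.\<close>
    have image: "(\<lambda>r. r\<^sup>2) ` {0<..<1} = {0<..<1::real}"
    proof (intro equalityI subsetI)
      fix m :: real assume "m \<in> {0<..<1}"
      then show "m \<in> (\<lambda>r. r\<^sup>2) ` {0<..<1}"
        by (intro image_eqI[of _ _ "sqrt m"]) auto
    qed (auto simp: power_less_one_iff abs_square_less_1)
    have "(\<forall>m\<in>(\<lambda>r. r\<^sup>2) ` {0<..<1::real}. P m) \<longleftrightarrow> (\<forall>r\<in>{0<..<1}. P (r\<^sup>2))" for P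
      by simp
    from this[of "\<lambda>m. two_point_mean \<beta> m < arcsine_mean m \<and> arcsine_mean m < two_point_mean \<alpha> m"]
    show ?thesis
      unfolding image by (rule sym)
  qed
  also have "\<dots> \<longleftrightarrow> \<beta> \<le> 1/2 - 2 * sqrt (2 * (pi\<^sup>2 - 8)) / pi\<^sup>2 \<and> \<alpha> \<ge> 1/2 - sqrt 2 / 4"
    (is "?bounds \<longleftrightarrow> ?params")
  proof
    assume ?bounds
    then show ?params
      using assms by (intro conjI lower_bound_necessary upper_bound_necessary) auto
  next
    assume ?params
    define s where "s = 2 * sqrt (2 * (pi\<^sup>2 - 8)) / pi\<^sup>2"
    have s: "0 \<le> s" "s \<le> 2/5" "13/100 \<le> s\<^sup>2"
      unfolding s_def by (rule critical_shift_bounds)+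
    have s_le: "sqrt (1/2 - s) + sqrt (1/2 + s) \<le> 4 / pi"
      using s sqrt_add_sqrt_le_iff[of s, folded s_def] by simp
    have \<beta>_le: "\<beta> \<le> 1/2 - s" and \<alpha>_ge: "1/2 - sqrt 2 / 4 \<le> \<alpha>"
      using \<open>?params\<close> unfolding s_def by blast+
    show ?bounds
    proof (intro ballI conjI)
      fix m :: real assume m: "m \<in> {0<..<1}"
      have "two_point_mean \<beta> m \<le> two_point_mean (1/2 - s) m"
        using \<beta>_le assms m s by (intro two_point_mean_mono) auto
      also have "\<dots> < arcsine_mean m"
        using m s s_le by (intro two_point_lower) auto
      finally show "two_point_mean \<beta> m < arcsine_mean m" .
      \<comment> \<open>This makes the smaller Gauss-Chebyshev node nonnegative, as monotonicity in
        the node requires.\<close>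
      have "sqrt 2 \<le> 2"
        by (rule real_le_lsqrt) auto
      have "arcsine_mean m < two_point_mean (1/2 - sqrt 2 / 4) m"
        using m by (intro gauss_chebyshev_upper) auto
      also have "\<dots> \<le> two_point_mean \<alpha> m"
        using \<alpha>_ge assms m \<open>sqrt 2 \<le> 2\<close> by (intro two_point_mean_mono) auto
      finally show "arcsine_mean m < two_point_mean \<alpha> m" .
    qed
  qed
  finally show ?thesis .
qed

end
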